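(* Let $F(n)=\sum_{\pi\in S_n}q^{(ba)(\pi)}$ for $n\ge 0$ (so $F(0)=1$). Then for all $n\ge1$, $$F(n)=\sum_{k=1}^n\binom nk (q-1)^{k-1}F(n-k).$$
   Context: $S_n$ is the set of permutations $\pi=\pi_1\cdots\pi_n$ of $\{1,\dots,n\}$ in one-line notation, and $(ba)(\pi)=|\{i:\pi_i>\pi_{i+1}\}|$ is the number of descents. *)

theory Defs
  imports "HOL-Combinatorics.Multiset_Permutations"
begin

text \<open>
  A permutation in one-line notation is the list of its values. List positions are counted
  from 0, so the descent position \<open>i\<close> of the permutation is the list position \<open>i - 1\<close>.
\<close>

definition descents :: "nat list \<Rightarrow> nat" where
  "descents xs = card {i. Suc i < length xs \<and> xs ! i > xs ! Suc i}"

text \<open>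
  \<open>q\<close> ranges over an arbitrary commutative ring; taking the ring to be \<open>int poly\<close> and \<open>q\<close> the
  polynomial variable gives the formal generating polynomial.
\<close>

definition descent_gf :: "'a::comm_ring_1 \<Rightarrow> nat \<Rightarrow> 'a" where
  "descent_gf q n = (\<Sum>xs\<in>permutations_of_set {1..n}. q ^ descents xs)"

end

theory Submission
  imports Defs "HOL-Library.Infinite_Set"
begin

text \<open>
  For every nonempty list, \<open>q ^ descents xs\<close> is the sum of \<open>(q - 1) ^ (k - 1) * q ^ descents (drop k xs)\<close>
  over all \<open>k \<ge> 1\<close> for which the first \<open>k\<close> entries decrease; this is an induction on the list
  that uses only \<open>q = 1 + (q - 1)\<close>. Summing over all permutations, one counts for each \<open>k\<close>
  the permutations whose first \<open>k\<close> entries decrease. Such a permutation is determined by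
  the set of its first \<open>k\<close> entries and the arrangement of the remaining ones.
\<close>

lemma descents_Nil [simp]: "descents [] = 0"
  by (simp add: descents_def)

lemma descents_singleton [simp]: "descents [x] = 0"
  by (simp add: descents_def)

lemma descents_Cons_Cons:
  "descents (x # y # zs) = (if y < x then 1 else 0) + descents (y # zs)"
proof -
  let ?S = "{i. Suc i < length (y # zs) \<and> (y # zs) ! i > (y # zs) ! Suc i}"
  have fin: "finite ?S"
    by (rule finite_subset[of _ "{..<length (y # zs)}"]) auto
  \<comment> \<open>Position 0 records the comparison of \<open>x\<close> with \<open>y\<close>;
    every later descent position is one of \<open>y # zs\<close> shifted by one.\<close>
  have "{i. Suc i < length (x # y # zs) \<and> (x # y # zs) ! i > (x # y # zs) ! Suc i}
        = (if y < x then {0} else {}) \<union> Suc ` ?S" (is "?L = ?R")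
  proof (rule set_eqI)
    fix i show "i \<in> ?L \<longleftrightarrow> i \<in> ?R"
      by (cases i) auto
  qed
  moreover have "card (Suc ` ?S) = card ?S"
    by (simp add: card_image)
  ultimately show ?thesis
    using fin by (simp add: descents_def)
qed

text \<open>Only comparisons of adjacent entries matter, and \<open>f\<close> preserves them. This
  allows entries to be relabelled by \<open>{1..n}\<close>.\<close>

lemma descents_map:
  assumes "strict_mono_on A f" "set xs \<subseteq> A"
  shows "descents (map f xs) = descents xs"
  using assms(2)
proof (induction xs rule: induct_list012)
  case (3 x y zs)
  then have "f y < f x \<longleftrightarrow> y < x"
    using strict_mono_on_less[OF assms(1), of y x] by auto
  with 3 show ?case by (simp add: descents_Cons_Cons)
qed simp_all

text \<open>For \<open>x # y # zs\<close>, the term \<open>k = 1\<close> is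
  \<open>q ^ descents (y # zs)\<close>, as a one-entry prefix always decreases. If
  \<open>y < x\<close>, the later terms are \<open>q - 1\<close> times the sum for
  \<open>y # zs\<close>; otherwise they vanish. The total is thus \<open>q\<close> or 1 times
  \<open>q ^ descents (y # zs)\<close>.\<close>

lemma power_descents_eq:
  fixes q :: "'a::comm_ring_1"
  assumes "xs \<noteq> []"
  shows "q ^ descents xs =
    (\<Sum>k=1..length xs. if sorted_wrt (>) (take k xs)
       then (q - 1) ^ (k - 1) * q ^ descents (drop k xs) else 0)"
  using assms
proof (induction xs rule: induct_list012)
  case (3 x y zs)
  let ?t = "\<lambda>xs k. if sorted_wrt (>) (take k xs)
       then (q - 1) ^ (k - 1) * q ^ descents (drop k xs) else 0"
  have dec: "sorted_wrt (>) (take (Suc k) (x # y # zs)) \<longleftrightarrow>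
      y < x \<and> sorted_wrt (>) (take k (y # zs))" if "k \<ge> 1" for k
    using that by (cases k) auto
  \<comment> \<open>The extra factor \<open>q - 1\<close> arises because \<open>k \<ge> 1\<close>
    makes \<open>Suc k - 1\<close> equal to \<open>Suc (k - 1)\<close> despite truncated
    subtraction.\<close>
  have tail: "?t (x # y # zs) (Suc k) = (if y < x then (q - 1) * ?t (y # zs) k else 0)"
    if "k \<in> {1..length (y # zs)}" for k
  proof -
    from that obtain m where "k = Suc m" by (cases k) auto
    then show ?thesis using dec[of k] by (simp add: mult.assoc)
  qed
  have "(\<Sum>k=1..length (x # y # zs). ?t (x # y # zs) k) =
      ?t (x # y # zs) 1 + (\<Sum>k=Suc 1..Suc (length (y # zs)). ?t (x # y # zs) k)"
    by (subst sum.atLeast_Suc_atMost) simp_all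
  also have "(\<Sum>k=Suc 1..Suc (length (y # zs)). ?t (x # y # zs) k) =
      (\<Sum>k=1..length (y # zs). ?t (x # y # zs) (Suc k))"
    by (rule sum.shift_bounds_cl_Suc_ivl)
  also have "\<dots> = (\<Sum>k=1..length (y # zs). if y < x then (q - 1) * ?t (y # zs) k else 0)"
    by (rule sum.cong[OF refl tail])
  also have "\<dots> = (if y < x then (q - 1) * (\<Sum>k=1..length (y # zs). ?t (y # zs) k) else 0)"
    by (simp only: sum_distrib_left sum.neutral_const split: if_split) simp
  also have "\<dots> = (if y < x then (q - 1) * q ^ descents (y # zs) else 0)"
    using "3.IH"(2) by (simp only: list.distinct not_False_eq_True)
  finally show ?case
    by (simp add: descents_Cons_Cons algebra_simps)
qed simp_all

lemma sum_power_descents: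
  fixes q :: "'a::comm_ring_1" and A :: "nat set"
  assumes "finite A"
  shows "(\<Sum>xs\<in>permutations_of_set A. q ^ descents xs) = descent_gf q (card A)"
proof -
  obtain h where h: "bij_betw h {..<card A} A" "strict_mono_on {..<card A} h"
    using assms ex_bij_betw_strict_mono_card by blast
  \<comment> \<open>\<open>h\<close> enumerates \<open>A\<close> in increasing order from index 0,
    whereas \<open>descent_gf\<close> permutes \<open>{1..n}\<close>; hence the shift.\<close>
  define f where "f = (\<lambda>i. h (i - 1))"
  have "bij_betw (\<lambda>i. i - 1) {1..card A} {..<card A}"
    by (rule bij_betwI[where g = Suc]) auto
  then have "bij_betw f {1..card A} A"
    using bij_betw_trans[OF _ h(1)] by (simp add: f_def comp_def)
  moreover have mono: "strict_mono_on {1..card A} f"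
    unfolding f_def by (intro strict_mono_onI strict_mono_onD[OF h(2)]) auto
  ultimately have inj: "inj_on f {1..card A}" and img: "f ` {1..card A} = A"
    by (auto simp: bij_betw_def)
  have perms: "permutations_of_set A = map f ` permutations_of_set {1..card A}"
    using permutations_of_set_image_inj[OF inj] by (simp only: img)
  have "inj_on (map f) (permutations_of_set {1..card A})"
    by (rule inj_on_mapI[OF inj_on_subset[OF inj]])
       (auto simp: permutations_of_set_def)
  then have "(\<Sum>xs\<in>permutations_of_set A. q ^ descents xs) =
      (\<Sum>xs\<in>permutations_of_set {1..card A}. q ^ descents (map f xs))"
    by (simp add: perms sum.reindex)
  also have "\<dots> = descent_gf q (card A)"
    unfolding descent_gf_def
    by (intro sum.cong refl arg_cong[of _ _ "\<lambda>d. q ^ d"] descents_map[OF mono])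
       (simp add: permutations_of_set_def)
  finally show ?thesis .
qed

lemma sorted_wrt_greater_eq_rev_sorted_list_of_set:
  fixes xs :: "'a::linorder list"
  assumes "sorted_wrt (>) xs"
  shows "rev (sorted_list_of_set (set xs)) = xs"
proof -
  have "sorted_wrt (<) (rev xs)"
    using assms by (simp add: sorted_wrt_rev)
  then have "sorted_list_of_set (set (rev xs)) = rev xs"
    by (rule sorted_list_of_set.idem_if_sorted_distinct[OF strict_sorted_imp_sorted])
       (use \<open>sorted_wrt (<) (rev xs)\<close> strict_sorted_iff in blast)
  then show ?thesis by simp
qed

text \<open>A decreasing prefix is recovered from its set of entries by sorting, so the inverse map
  lists \<open>B\<close> in decreasing order and appends the remaining entries.\<close>

lemma bij_betw_decreasing_prefix:
  fixes A :: "'a::linorder set"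
  assumes "finite A" "k \<le> card A"
  shows "bij_betw (\<lambda>xs. (set (take k xs), drop k xs))
    {xs \<in> permutations_of_set A. sorted_wrt (>) (take k xs)}
    (SIGMA B:{B. B \<subseteq> A \<and> card B = k}. permutations_of_set (A - B))"
proof (rule bij_betwI[where g = "\<lambda>(B, ys). rev (sorted_list_of_set B) @ ys"])
  show "(\<lambda>xs. (set (take k xs), drop k xs)) \<in>
      {xs \<in> permutations_of_set A. sorted_wrt (>) (take k xs)} \<rightarrow>
      (SIGMA B:{B. B \<subseteq> A \<and> card B = k}. permutations_of_set (A - B))"
  proof
    fix xs assume "xs \<in> {xs \<in> permutations_of_set A. sorted_wrt (>) (take k xs)}"
    then have xs: "set xs = A" "distinct xs"
      by (auto simp: permutations_of_set_def)
    then have len: "length xs = card A"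
      using distinct_card by fastforce
    have "set (take k xs) \<union> set (drop k xs) = A"
      using xs(1) by (metis append_take_drop_id set_append)
    moreover have "set (take k xs) \<inter> set (drop k xs) = {}"
      using xs(2) by (simp add: set_take_disj_set_drop_if_distinct)
    \<comment> \<open>The bound \<open>k \<le> card A\<close> ensures that \<open>take k xs\<close>
      really has \<open>k\<close> entries.\<close>
    moreover have "card (set (take k xs)) = k"
      using xs(2) len assms(2) by (simp add: distinct_card)
    ultimately show "(set (take k xs), drop k xs) \<in>
        (SIGMA B:{B. B \<subseteq> A \<and> card B = k}. permutations_of_set (A - B))"
      using xs(2) by (auto simp: permutations_of_set_def)
  qed
  show "(\<lambda>(B, ys). rev (sorted_list_of_set B) @ ys) \<in>
      (SIGMA B:{B. B \<subseteq> A \<and> card B = k}. permutations_of_set (A - B)) \<rightarrow>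
      {xs \<in> permutations_of_set A. sorted_wrt (>) (take k xs)}"
  proof -
    \<comment> \<open>Finiteness is what makes \<open>sorted_list_of_set B\<close> list
      \<open>B\<close>; on infinite sets it defaults to \<open>[]\<close>.\<close>
    have "finite B" if "B \<subseteq> A" for B
      using that assms(1) by (rule finite_subset)
    then show ?thesis
      by (auto simp: permutations_of_set_def sorted_wrt_rev)
  qed
  show "(\<lambda>(B, ys). rev (sorted_list_of_set B) @ ys) (set (take k xs), drop k xs) = xs"
    if "xs \<in> {xs \<in> permutations_of_set A. sorted_wrt (>) (take k xs)}" for xs
    using that sorted_wrt_greater_eq_rev_sorted_list_of_set[of "take k xs"] by simp
  show "(\<lambda>xs. (set (take k xs), drop k xs)) ((\<lambda>(B, ys). rev (sorted_list_of_set B) @ ys) p) = p"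
    if "p \<in> (SIGMA B:{B. B \<subseteq> A \<and> card B = k}. permutations_of_set (A - B))" for p
    using that finite_subset[OF _ assms(1)] by auto
qed

theorem mainTheorem5:
  fixes q :: "'a::comm_ring_1" and n :: nat
  assumes "n \<ge> 1"
  shows "descent_gf q n = (\<Sum>k=1..n. of_nat (n choose k) * (q - 1) ^ (k - 1) * descent_gf q (n - k))"
proof -
  let ?P = "permutations_of_set {1..n}"
  let ?D = "\<lambda>k. {xs \<in> ?P. sorted_wrt (>) (take k xs)}"
  have prefix_sum: "(\<Sum>xs\<in>?D k. q ^ descents (drop k xs)) =
      of_nat (n choose k) * descent_gf q (n - k)" if "k \<in> {1..n}" for k
  proof -
    let ?B = "{B. B \<subseteq> {1..n} \<and> card B = k}"
    have "(\<Sum>xs\<in>?D k. q ^ descents (drop k xs)) =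
        (\<Sum>(B, ys)\<in>(SIGMA B:?B. permutations_of_set ({1..n} - B)). q ^ descents ys)"
      using sum.reindex_bij_betw[OF bij_betw_decreasing_prefix[of "{1..n}" k],
          of "\<lambda>(B, ys). q ^ descents ys"] that by simp
    also have "\<dots> = (\<Sum>B\<in>?B. \<Sum>ys\<in>permutations_of_set ({1..n} - B). q ^ descents ys)"
      by (rule sum.Sigma[symmetric]) auto
    \<comment> \<open>Each complement has \<open>n - k\<close> elements, so the inner sum does not
      depend on the choice of \<open>B\<close>.\<close>
    also have "\<dots> = (\<Sum>B\<in>?B. descent_gf q (n - k))"
      by (rule sum.cong[OF refl]) (auto simp: sum_power_descents card_Diff_subset finite_subset)
    also have "\<dots> = of_nat (n choose k) * descent_gf q (n - k)"
      by (simp add: n_subsets)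
    finally show ?thesis .
  qed
  have "descent_gf q n = (\<Sum>xs\<in>?P. \<Sum>k=1..n. if sorted_wrt (>) (take k xs)
      then (q - 1) ^ (k - 1) * q ^ descents (drop k xs) else 0)"
    unfolding descent_gf_def
  proof (rule sum.cong[OF refl])
    fix xs assume "xs \<in> ?P"
    then have "length xs = n"
      by (simp add: length_finite_permutations_of_set)
    \<comment> \<open>This is where \<open>n \<ge> 1\<close> enters: for the empty list the sum over
      \<open>k\<close> is empty, while \<open>q ^ 0 = 1\<close>.\<close>
    moreover from this assms have "xs \<noteq> []" by auto
    ultimately show "q ^ descents xs = (\<Sum>k=1..n. if sorted_wrt (>) (take k xs)
        then (q - 1) ^ (k - 1) * q ^ descents (drop k xs) else 0)"
      using power_descents_eq[of xs q] by simp
  qed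
  also have "\<dots> = (\<Sum>k=1..n. \<Sum>xs\<in>?P. if sorted_wrt (>) (take k xs)
      then (q - 1) ^ (k - 1) * q ^ descents (drop k xs) else 0)"
    by (rule sum.swap)
  also have "\<dots> = (\<Sum>k=1..n. (q - 1) ^ (k - 1) * (\<Sum>xs\<in>?D k. q ^ descents (drop k xs)))"
    by (simp add: sum.inter_filter[symmetric] sum_distrib_left)
  also have "\<dots> = (\<Sum>k=1..n. of_nat (n choose k) * (q - 1) ^ (k - 1) * descent_gf q (n - k))"
    by (rule sum.cong[OF refl]) (simp only: prefix_sum mult_ac)
  finally show ?thesis .
qed

end
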